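(* Assume the linear model $Y_i=\beta^TX_i+\epsilon_i$, $i=1,\dots,n$, described in the context, and additionally that $X$ has moments of all orders. Then the oracle estimator $$T_{oracle}=\hat\tau^2-2\sum_{j=1}^p\sum_{j'=1}^p\psi_{jj'},\qquad \psi_{jj'}=\beta_j\beta_{j'}h_{jj'},\qquad h_{jj'}=\frac1n\sum_{i=1}^n\left[X_{ij}X_{ij'}-E(X_{ij}X_{ij'})\right],$$ is an optimal oracle estimator (OOE) of $\tau^2$ with respect to the family $\mathcal{G}$ of zero-estimators generated by $$g_{k_1\ldots k_p}=\frac1n\sum_{i=1}^n\left[X_{i1}^{k_1}\cdots X_{ip}^{k_p}-E\left(X_{i1}^{k_1}\cdots X_{ip}^{k_p}\right)\right],\qquad (k_1,\dots,k_p)\in\mathbb{N}_0^p=\{0,1,2,\dots\}^p .$$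
   Context: Setting. $(X_1,Y_1),\dots,(X_n,Y_n)$ are i.i.d. with $X_i=(X_{i1},\dots,X_{ip})^T\in\mathbb{R}^p$, $Y_i\in\mathbb{R}$, and $Y_i=\beta^TX_i+\epsilon_i$ with $E(\epsilon_i|X_i)=0$, $E(\epsilon_i^2|X_i)=\sigma^2$. The distribution of $X$ is known, and $E(X)=0$, $\mathrm{Cov}(X)=\mathbf{I}$. The unknown parameters (denoted $\theta$) are $\beta$, $\sigma^2$ and the conditional law of $\epsilon$ given $X$. The signal level is $\tau^2=\|\beta\|^2$. Put $W_{ij}=X_{ij}Y_i$, $W_i=(W_{i1},\dots,W_{ip})^T$. The naive estimator, which is unbiased for $\tau^2$, is $\hat\tau^2=\binom n2^{-1}\sum_{i_1<i_2}W_{i_1}^TW_{i_2}$. A zero-estimator is a statistic with expectation $0$ under all parameter values. $\mathcal{G}$ is the set of all finite linear combinations of the $g_{k_1\ldots k_p}$. Given an unbiased estimator $T$ of a quantity (here $T=\hat\tau^2$ for $\tau^2$) and $g^*\in\mathcal{G}$ (whose coefficients are allowed to depend on the unknown parameters), $R^*=T+g^*$ is called an optimal oracle estimator (OOE) with respect to $\mathcal{G}$ if $\mathrm{Var}_\theta[T+g^*]\le\mathrm{Var}_\theta[T+g]$ for all $g\in\mathcal{G}$ and all $\theta$. *)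

theory Defs
  imports "HOL-Probability.Probability"
begin

section \<open>Estimators in a parametrised statistical model\<close>

text \<open>A model is a parameter set \<open>\<Theta>\<close> with a law \<open>P \<theta>\<close> of the whole data set for each \<open>\<theta>\<close>.
  A statistic is a real function of the data; an oracle statistic may also depend on \<open>\<theta>\<close>.\<close>

definition zero_estimator ::
    "'t set \<Rightarrow> ('t \<Rightarrow> 'd measure) \<Rightarrow> ('d \<Rightarrow> real) \<Rightarrow> bool" where
  "zero_estimator \<Theta> P g \<longleftrightarrow>
     (\<forall>\<theta>\<in>\<Theta>. integrable (P \<theta>) g \<and> prob_space.expectation (P \<theta>) g = 0)"

definition unbiased_estimator ::
    "'t set \<Rightarrow> ('t \<Rightarrow> 'd measure) \<Rightarrow> ('t \<Rightarrow> real) \<Rightarrow> ('d \<Rightarrow> real) \<Rightarrow> bool" where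
  "unbiased_estimator \<Theta> P q T \<longleftrightarrow>
     (\<forall>\<theta>\<in>\<Theta>. integrable (P \<theta>) T \<and> prob_space.expectation (P \<theta>) T = q \<theta>)"

text \<open>\<open>R\<close> is an optimal oracle estimator of \<open>q\<close>, built from the unbiased estimator \<open>T\<close> and the
  family \<open>G\<close> of zero-estimators. The coefficients of \<open>g\<^sup>* \<in> G\<close> may depend on the parameter, so
  \<open>g\<^sup>*\<close> is chosen after \<open>\<theta>\<close>. Square-integrability is demanded because \<open>variance\<close> is a Bochner
  integral, which is \<open>0\<close> by convention when the true variance is infinite.\<close>

definition optimal_oracle_estimator ::
    "'t set \<Rightarrow> ('t \<Rightarrow> 'd measure) \<Rightarrow> ('t \<Rightarrow> real) \<Rightarrow> ('d \<Rightarrow> real) \<Rightarrow> ('d \<Rightarrow> real) set \<Rightarrow>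
     ('t \<Rightarrow> 'd \<Rightarrow> real) \<Rightarrow> bool" where
  "optimal_oracle_estimator \<Theta> P q T G R \<longleftrightarrow>
     unbiased_estimator \<Theta> P q T \<and>
     (\<forall>g\<in>G. zero_estimator \<Theta> P g) \<and>
     (\<forall>\<theta>\<in>\<Theta>. \<exists>gs\<in>G. R \<theta> = (\<lambda>d. T d + gs d)) \<and>
     (\<forall>g\<in>G. \<forall>\<theta>\<in>\<Theta>.
        integrable (P \<theta>) (\<lambda>d. (T d + g d)\<^sup>2) \<and>
        prob_space.variance (P \<theta>) (R \<theta>) \<le> prob_space.variance (P \<theta>) (\<lambda>d. T d + g d))"


section \<open>The known covariate distribution\<close>

definition monomial :: "('p \<Rightarrow> nat) \<Rightarrow> real^'p::finite \<Rightarrow> real" where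
  "monomial k x = (\<Prod>j\<in>UNIV. (x $ j) ^ k j)"

definition has_all_moments :: "(real^'p::finite) measure \<Rightarrow> bool" where
  "has_all_moments \<mu> \<longleftrightarrow> (\<forall>k. integrable \<mu> (monomial k))"

definition mean_vector :: "(real^'p::finite) measure \<Rightarrow> real^'p" where
  "mean_vector \<mu> = (\<chi> j. \<integral>x. x $ j \<partial>\<mu>)"

definition covariance_matrix :: "(real^'p::finite) measure \<Rightarrow> real^'p^'p" where
  "covariance_matrix \<mu> =
     (\<chi> j j'. \<integral>x. (x $ j - mean_vector \<mu> $ j) * (x $ j' - mean_vector \<mu> $ j') \<partial>\<mu>)"


section \<open>The linear model with random covariates\<close>

text \<open>The parameter consists of \<open>\<beta>\<close>, \<open>\<sigma>\<^sup>2\<close> and the conditional law of the error given the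
  covariates, as a probability kernel \<open>x \<mapsto> err_law x\<close>.\<close>

record 'p lm_param =
  coef :: "real^'p"
  sigma2 :: real
  err_law :: "real^'p \<Rightarrow> real measure"

text \<open>Law of one observation \<open>(X, \<beta>\<^sup>TX + \<epsilon>)\<close>, where \<open>X \<sim> \<mu>\<close> and \<open>\<epsilon>\<close> has law \<open>err_law x\<close> given
  \<open>X = x\<close>.\<close>

definition obs_law ::
    "(real^'p::finite) measure \<Rightarrow> 'p lm_param \<Rightarrow> ((real^'p) \<times> real) measure" where
  "obs_law \<mu> \<theta> = \<mu> \<bind> (\<lambda>x. distr (err_law \<theta> x) borel (\<lambda>e. (x, coef \<theta> \<bullet> x + e)))"

definition residual :: "'p::finite lm_param \<Rightarrow> (real^'p) \<times> real \<Rightarrow> real" where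
  "residual \<theta> z = snd z - coef \<theta> \<bullet> fst z"

definition sigma_X :: "((real^'p::finite) \<times> real) measure" where
  "sigma_X = vimage_algebra UNIV fst borel"

definition lm_params :: "(real^'p::finite) measure \<Rightarrow> 'p lm_param set" where
  "lm_params \<mu> = {\<theta>.
     err_law \<theta> \<in> measurable borel (prob_algebra borel) \<and>
     integrable (obs_law \<mu> \<theta>) (residual \<theta>) \<and>
     integrable (obs_law \<mu> \<theta>) (\<lambda>z. (residual \<theta> z)\<^sup>2) \<and>
     (AE z in obs_law \<mu> \<theta>. real_cond_exp (obs_law \<mu> \<theta>) sigma_X (residual \<theta>) z = 0) \<and>
     (AE z in obs_law \<mu> \<theta>.
        real_cond_exp (obs_law \<mu> \<theta>) sigma_X (\<lambda>z. (residual \<theta> z)\<^sup>2) z = sigma2 \<theta>)}"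

text \<open>A data set is \<open>d\<close> with \<open>d i = (X\<^sub>i, Y\<^sub>i)\<close> for \<open>i = 1, \<dots>, n\<close>; i.i.d. sampling is the product
  law.\<close>

definition sample_law ::
    "nat \<Rightarrow> (real^'p::finite) measure \<Rightarrow> 'p lm_param \<Rightarrow> (nat \<Rightarrow> (real^'p) \<times> real) measure" where
  "sample_law n \<mu> \<theta> = PiM {1..n} (\<lambda>_. obs_law \<mu> \<theta>)"

definition tau2 :: "'p::finite lm_param \<Rightarrow> real" where
  "tau2 \<theta> = (norm (coef \<theta>))\<^sup>2"

definition W :: "(nat \<Rightarrow> (real^'p::finite) \<times> real) \<Rightarrow> nat \<Rightarrow> real^'p" where
  "W d i = (\<chi> j. fst (d i) $ j * snd (d i))"

definition naive_est :: "nat \<Rightarrow> (nat \<Rightarrow> (real^'p::finite) \<times> real) \<Rightarrow> real" where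
  "naive_est n d =
     inverse (real (n choose 2)) * (\<Sum>(i1, i2)\<in>{(i1, i2). 1 \<le> i1 \<and> i1 < i2 \<and> i2 \<le> n}. W d i1 \<bullet> W d i2)"

definition g_zero ::
    "nat \<Rightarrow> (real^'p::finite) measure \<Rightarrow> ('p \<Rightarrow> nat) \<Rightarrow> (nat \<Rightarrow> (real^'p) \<times> real) \<Rightarrow> real" where
  "g_zero n \<mu> k d =
     1 / real n * (\<Sum>i=1..n. (monomial k (fst (d i)) - (\<integral>x. monomial k x \<partial>\<mu>)))"

definition zero_family ::
    "nat \<Rightarrow> (real^'p::finite) measure \<Rightarrow> ((nat \<Rightarrow> (real^'p) \<times> real) \<Rightarrow> real) set" where
  "zero_family n \<mu> = {(\<lambda>d. \<Sum>k\<in>K. c k * g_zero n \<mu> k d) | K c. finite K}"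

definition h_stat ::
    "nat \<Rightarrow> (real^'p::finite) measure \<Rightarrow> 'p \<Rightarrow> 'p \<Rightarrow> (nat \<Rightarrow> (real^'p) \<times> real) \<Rightarrow> real" where
  "h_stat n \<mu> j j' d =
     1 / real n * (\<Sum>i=1..n. (fst (d i) $ j * fst (d i) $ j' - (\<integral>x. x $ j * x $ j' \<partial>\<mu>)))"

definition psi_stat ::
    "nat \<Rightarrow> (real^'p::finite) measure \<Rightarrow> 'p lm_param \<Rightarrow> 'p \<Rightarrow> 'p \<Rightarrow>
     (nat \<Rightarrow> (real^'p) \<times> real) \<Rightarrow> real" where
  "psi_stat n \<mu> \<theta> j j' d = coef \<theta> $ j * coef \<theta> $ j' * h_stat n \<mu> j j' d"

definition T_oracle ::
    "nat \<Rightarrow> (real^'p::finite) measure \<Rightarrow> 'p lm_param \<Rightarrow> (nat \<Rightarrow> (real^'p) \<times> real) \<Rightarrow> real" where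
  "T_oracle n \<mu> \<theta> d = naive_est n d - 2 * (\<Sum>j\<in>UNIV. \<Sum>j'\<in>UNIV. psi_stat n \<mu> \<theta> j j' d)"

end

theory Submission
  imports Defs
begin

text \<open>
  Fix a parameter. The family of zero-estimators is a linear space \<open>G\<close> of square-integrable,
  centred statistics, so an element \<open>g\<^sub>0\<close> of \<open>G\<close> minimises the variance of \<open>T + g\<close> as soon as
  \<open>T + g\<^sub>0\<close> is uncorrelated with all of \<open>G\<close>: for any other \<open>g\<close>, the difference \<open>D = g - g\<^sub>0\<close> lies
  in \<open>G\<close>, and \<open>Var (T + g) = Var (T + g\<^sub>0) + Var D\<close>. This is \<open>variance_le_of_uncorrelated\<close>
  together with \<open>zero_family_diff\<close>.

  Every \<open>g\<close> in \<open>G\<close> is the sample average of \<open>m X\<close> for a centred polynomial \<open>m\<close>. The naive estimator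
  is the sum over \<open>j\<close> of the U-statistics with kernel \<open>w\<^sub>j z * w\<^sub>j z'\<close>, where \<open>w\<^sub>j = X\<^sub>j Y\<close> has mean
  \<open>\<beta>\<^sub>j\<close>. Each pair contains two single observations, so the covariance of such a U-statistic
  with a sample average is \<open>2/n * \<beta>\<^sub>j * E (X\<^sub>j Y m X)\<close>
  (\<open>integral_pair_average_times_sample_average\<close>). The error is orthogonal to functions of the
  covariates, so \<open>Y\<close> may be replaced by \<open>\<beta>\<^sup>TX\<close>, and summing over \<open>j\<close> gives
  \<open>2/n * E ((\<beta>\<^sup>TX)\<^sup>2 m X)\<close>. The correction subtracted in the oracle estimator is twice the centred
  sample average of \<open>(\<beta>\<^sup>TX)\<^sup>2\<close>, and its covariance with \<open>g\<close> is the same number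
  (\<open>T_oracle_uncorrelated\<close>). Since \<open>(\<beta>\<^sup>TX)\<^sup>2\<close> is a polynomial, the correction belongs to \<open>G\<close>.

  The analytic point is square-integrability of \<open>T\<close>. It needs only \<open>X\<^sub>j \<epsilon>\<close> in \<open>L\<^sup>2\<close>, although no
  moment of \<open>\<epsilon>\<close> beyond the second is available: since \<open>E (\<epsilon>\<^sup>2 | X)\<close> is constant, \<open>X\<^sub>j\<^sup>2 \<epsilon>\<^sup>2\<close> has
  expectation \<open>\<sigma>\<^sup>2 E X\<^sub>j\<^sup>2\<close> (\<open>integrable_mult_of_real_cond_exp_const\<close>). Independence of distinct
  observations then puts the products \<open>W\<^bsub>ij\<^esub> W\<^bsub>kj\<^esub>\<close> in \<open>L\<^sup>2\<close> as well.
\<close>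

(* Keeps the index set {1..n} from being rewritten to {Suc 0..n}. *)
declare One_nat_def [simp del]

section \<open>Square-integrable functions\<close>

definition square_integrable :: "'a measure \<Rightarrow> ('a \<Rightarrow> real) \<Rightarrow> bool" where
  "square_integrable M f \<longleftrightarrow> f \<in> borel_measurable M \<and> integrable M (\<lambda>x. (f x)\<^sup>2)"

lemma square_integrable_measurable:
  "square_integrable M f \<Longrightarrow> f \<in> borel_measurable M"
  by (simp add: square_integrable_def)

lemma square_integrable_power2:
  "square_integrable M f \<Longrightarrow> integrable M (\<lambda>x. (f x)\<^sup>2)"
  by (simp add: square_integrable_def)

lemma square_integrable_mult:
  assumes f: "square_integrable M f" and g: "square_integrable M g"
  shows "integrable M (\<lambda>x. f x * g x)"
proof (rule Bochner_Integration.integrable_bound)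
  show "integrable M (\<lambda>x. (f x)\<^sup>2 + (g x)\<^sup>2)"
    using assms by (simp add: square_integrable_def)
  show "(\<lambda>x. f x * g x) \<in> borel_measurable M"
    using assms by (auto simp: square_integrable_def)
  have "\<bar>a * b\<bar> \<le> \<bar>a\<^sup>2 + b\<^sup>2\<bar>" for a b :: real
  proof -
    have "2 * (\<bar>a\<bar> * \<bar>b\<bar>) \<le> a\<^sup>2 + b\<^sup>2"
      using sum_squares_bound[of "\<bar>a\<bar>" "\<bar>b\<bar>"] by simp
    moreover have "0 \<le> \<bar>a\<bar> * \<bar>b\<bar>" by simp
    ultimately show ?thesis unfolding abs_mult by linarith
  qed
  then show "AE x in M. norm (f x * g x) \<le> norm ((f x)\<^sup>2 + (g x)\<^sup>2)"
    by simp
qed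

lemma square_integrable_cmult:
  assumes "square_integrable M f"
  shows "square_integrable M (\<lambda>x. c * f x)"
  using assms by (auto simp: square_integrable_def power_mult_distrib)

lemma square_integrable_add:
  assumes f: "square_integrable M f" and g: "square_integrable M g"
  shows "square_integrable M (\<lambda>x. f x + g x)"
proof -
  have "integrable M (\<lambda>x. (f x)\<^sup>2 + (g x)\<^sup>2 + 2 * (f x * g x))"
    using f g square_integrable_mult[OF f g] by (simp add: square_integrable_def)
  then show ?thesis
    using f g by (auto simp: square_integrable_def power2_sum mult.assoc)
qed

lemma square_integrable_diff:
  assumes "square_integrable M f" "square_integrable M g"
  shows "square_integrable M (\<lambda>x. f x - g x)"
  using square_integrable_add[OF assms(1) square_integrable_cmult[OF assms(2), of "-1"]] by simp

lemma square_integrable_sum: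
  assumes "\<And>i. i \<in> I \<Longrightarrow> square_integrable M (f i)"
  shows "square_integrable M (\<lambda>x. \<Sum>i\<in>I. f i x)"
  using assms
proof (induction I rule: infinite_finite_induct)
  case (insert i I)
  then show ?case by (simp add: square_integrable_add)
qed (simp_all add: square_integrable_def)

lemma (in finite_measure) square_integrable_const: "square_integrable M (\<lambda>_. c)"
  by (simp add: square_integrable_def)

lemma (in finite_measure) square_integrable_integrable:
  "square_integrable M f \<Longrightarrow> integrable M f"
  by (simp add: square_integrable_def square_integrable_imp_integrable)

text \<open>Pythagoras: adding a centred variable that is uncorrelated with \<open>S\<close> adds its own variance.\<close>

lemma (in prob_space) variance_le_of_uncorrelated:
  assumes S: "square_integrable M S" and D: "square_integrable M D"
    and mean0: "expectation D = 0" and uncorr: "expectation (\<lambda>x. S x * D x) = 0"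
  shows "variance S \<le> variance (\<lambda>x. S x + D x)"
proof -
  note SD = square_integrable_add[OF S D]
  have exp: "expectation (\<lambda>x. S x + D x) = expectation S"
    using S D mean0 by (simp add: square_integrable_integrable)
  have "expectation (\<lambda>x. (S x + D x)\<^sup>2)
      = expectation (\<lambda>x. (S x)\<^sup>2 + (D x)\<^sup>2 + 2 * (S x * D x))"
    by (simp add: power2_sum mult.assoc)
  also have "\<dots> = expectation (\<lambda>x. (S x)\<^sup>2) + expectation (\<lambda>x. (D x)\<^sup>2)"
    using square_integrable_mult[OF S D] uncorr S D
    by (simp add: square_integrable_power2)
  finally have "expectation (\<lambda>x. (S x)\<^sup>2) \<le> expectation (\<lambda>x. (S x + D x)\<^sup>2)"
    by simp
  then show ?thesis
    using variance_eq[OF square_integrable_integrable[OF S] square_integrable_power2[OF S]]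
      variance_eq[OF square_integrable_integrable[OF SD] square_integrable_power2[OF SD]]
    unfolding exp by simp
qed

section \<open>Moments under i.i.d. sampling\<close>

text \<open>Coordinates outside \<open>J\<close> contribute the constant factor \<open>1\<close>, whose expectation is \<open>1\<close>; this
  extends the product formula over the whole index set to any part of it.\<close>

lemma iid_product:
  fixes f :: "'i \<Rightarrow> 'a \<Rightarrow> real"
  assumes M: "prob_space M" and I: "finite I" and J: "J \<subseteq> I"
    and f: "\<And>i. i \<in> J \<Longrightarrow> integrable M (f i)"
  shows "integrable (PiM I (\<lambda>_. M)) (\<lambda>d. \<Prod>i\<in>J. f i (d i))"
    and "(\<integral>d. (\<Prod>i\<in>J. f i (d i)) \<partial>PiM I (\<lambda>_. M)) = (\<Prod>i\<in>J. \<integral>x. f i x \<partial>M)"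
proof -
  interpret M: prob_space M by fact
  interpret product_sigma_finite "\<lambda>_. M" ..
  define h where "h i = (if i \<in> J then f i else (\<lambda>_. 1))" for i
  have h: "integrable M (h i)" for i using f by (simp add: h_def)
  have prod: "(\<Prod>i\<in>J. f i (d i)) = (\<Prod>i\<in>I. h i (d i))" for d
    using I J by (intro prod.mono_neutral_cong_left) (auto simp: h_def)
  show "integrable (PiM I (\<lambda>_. M)) (\<lambda>d. \<Prod>i\<in>J. f i (d i))"
    unfolding prod by (intro product_integrable_prod I h)
  have "(\<integral>d. (\<Prod>i\<in>J. f i (d i)) \<partial>PiM I (\<lambda>_. M)) = (\<Prod>i\<in>I. \<integral>x. h i x \<partial>M)"
    unfolding prod by (intro product_integral_prod I h)
  also have "\<dots> = (\<Prod>i\<in>J. \<integral>x. f i x \<partial>M)"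
    using I J by (intro prod.mono_neutral_cong_right) (auto simp: h_def M.prob_space)
  finally show "(\<integral>d. (\<Prod>i\<in>J. f i (d i)) \<partial>PiM I (\<lambda>_. M)) = (\<Prod>i\<in>J. \<integral>x. f i x \<partial>M)" .
qed

lemma iid_single:
  fixes f :: "'a \<Rightarrow> real"
  assumes "prob_space M" "finite I" "i \<in> I" "integrable M f"
  shows "integrable (PiM I (\<lambda>_. M)) (\<lambda>d. f (d i))"
    and "(\<integral>d. f (d i) \<partial>PiM I (\<lambda>_. M)) = (\<integral>x. f x \<partial>M)"
  using iid_product[OF assms(1,2), of "{i}" "\<lambda>_. f"] assms by simp_all

lemma iid_pair:
  fixes f g :: "'a \<Rightarrow> real"
  assumes "prob_space M" "finite I" "i \<in> I" "k \<in> I" "i \<noteq> k" "integrable M f" "integrable M g"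
  shows "integrable (PiM I (\<lambda>_. M)) (\<lambda>d. f (d i) * g (d k))"
    and "(\<integral>d. f (d i) * g (d k) \<partial>PiM I (\<lambda>_. M)) = (\<integral>x. f x \<partial>M) * (\<integral>x. g x \<partial>M)"
  using iid_product[OF assms(1,2), of "{i, k}" "\<lambda>l. if l = i then f else g"] assms
  by (simp_all add: if_distrib[of "\<lambda>h. h _"] cong: if_cong)

lemma iid_triple:
  fixes f g h :: "'a \<Rightarrow> real"
  assumes "prob_space M" "finite I" "i \<in> I" "k \<in> I" "l \<in> I" "i \<noteq> k" "i \<noteq> l" "k \<noteq> l"
    "integrable M f" "integrable M g" "integrable M h"
  shows "(\<integral>d. f (d i) * g (d k) * h (d l) \<partial>PiM I (\<lambda>_. M))
    = (\<integral>x. f x \<partial>M) * (\<integral>x. g x \<partial>M) * (\<integral>x. h x \<partial>M)"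
  using iid_product(2)[OF assms(1,2), of "{i, k, l}"
      "\<lambda>r. if r = i then f else if r = k then g else h"] assms
  by (simp add: mult.assoc)

lemma iid_square_integrable_single:
  assumes "prob_space M" "finite I" "i \<in> I" "square_integrable M f"
  shows "square_integrable (PiM I (\<lambda>_. M)) (\<lambda>d. f (d i))"
  using assms iid_single(1)[OF assms(1-3), of "\<lambda>x. (f x)\<^sup>2"]
  by (auto simp: square_integrable_def intro!: measurable_compose[OF measurable_component_singleton])

text \<open>For dependent factors, a product of two \<open>L\<^sup>2\<close> functions is in general only in \<open>L\<^sup>1\<close>; here the
  square of the product factorises by independence. This is what makes U-statistics with an \<open>L\<^sup>2\<close>
  product kernel square-integrable.\<close>

lemma iid_square_integrable_pair:
  assumes "prob_space M" "finite I" "i \<in> I" "k \<in> I" "i \<noteq> k"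
    "square_integrable M f" "square_integrable M g"
  shows "square_integrable (PiM I (\<lambda>_. M)) (\<lambda>d. f (d i) * g (d k))"
proof -
  have "(\<lambda>d. f (d i)) \<in> borel_measurable (PiM I (\<lambda>_. M))"
       "(\<lambda>d. g (d k)) \<in> borel_measurable (PiM I (\<lambda>_. M))"
    using assms by (auto simp: square_integrable_def
        intro!: measurable_compose[OF measurable_component_singleton])
  then show ?thesis
    using iid_pair(1)[OF assms(1-5), of "\<lambda>x. (f x)\<^sup>2" "\<lambda>x. (g x)\<^sup>2"] assms(6,7)
    by (auto simp add: square_integrable_def power_mult_distrib)
qed

text \<open>Of the three factors, the centred one survives integration only if it shares its observation
  with one of the others.\<close>

lemma iid_pair_times_centred:
  assumes M: "prob_space M" and I: "finite I" "i \<in> I" "k \<in> I" "l \<in> I" and "i \<noteq> k"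
    and w: "square_integrable M w" and m: "square_integrable M m" and m0: "(\<integral>x. m x \<partial>M) = 0"
  shows "(\<integral>d. w (d i) * w (d k) * m (d l) \<partial>PiM I (\<lambda>_. M))
    = (if l = i \<or> l = k then (\<integral>x. w x \<partial>M) * (\<integral>x. w x * m x \<partial>M) else 0)"
proof -
  interpret prob_space M by fact
  have iw: "integrable M w" and im: "integrable M m"
    using w m by (simp_all add: square_integrable_integrable)
  have iwm: "integrable M (\<lambda>x. w x * m x)"
    using w m by (rule square_integrable_mult)
  consider "l = i" | "l = k" | "l \<noteq> i" "l \<noteq> k" by blast
  then show ?thesis
  proof cases
    case 1
    then show ?thesis
      using iid_pair(2)[OF M I(1) I(3,2) _ iw iwm] \<open>i \<noteq> k\<close> by (simp add: ac_simps)
  next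
    case 2
    then show ?thesis
      using iid_pair(2)[OF M I(1) I(2,3) _ iw iwm] \<open>i \<noteq> k\<close> by (simp add: ac_simps)
  next
    case 3
    then show ?thesis
      using iid_triple[OF M I _ _ _ iw iw im] \<open>i \<noteq> k\<close> m0 by simp
  qed
qed

lemma integral_double_sum:
  fixes f :: "'i \<Rightarrow> 'k \<Rightarrow> 'a \<Rightarrow> real"
  assumes "\<And>i k. i \<in> I \<Longrightarrow> k \<in> K \<Longrightarrow> integrable M (f i k)"
  shows "(\<integral>x. (\<Sum>i\<in>I. \<Sum>k\<in>K. f i k x) \<partial>M) = (\<Sum>i\<in>I. \<Sum>k\<in>K. \<integral>x. f i k x \<partial>M)"
proof -
  have "(\<integral>x. (\<Sum>i\<in>I. \<Sum>k\<in>K. f i k x) \<partial>M) = (\<Sum>i\<in>I. \<integral>x. (\<Sum>k\<in>K. f i k x) \<partial>M)"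
    using assms by (intro Bochner_Integration.integral_sum Bochner_Integration.integrable_sum)
  also have "\<dots> = (\<Sum>i\<in>I. \<Sum>k\<in>K. \<integral>x. f i k x \<partial>M)"
    using assms by (intro sum.cong refl Bochner_Integration.integral_sum)
  finally show ?thesis .
qed

abbreviation index_pairs :: "nat \<Rightarrow> (nat \<times> nat) set" where
  "index_pairs n \<equiv> {(i1, i2). 1 \<le> i1 \<and> i1 < i2 \<and> i2 \<le> n}"

lemma finite_index_pairs: "finite (index_pairs n)"
  by (rule finite_subset[of _ "{1..n} \<times> {1..n}"]) auto

lemma card_index_pairs: "card (index_pairs n) = n choose 2"
proof (induction n)
  case 0
  have empty: "index_pairs 0 = {}" by auto
  show ?case unfolding empty by simp
next
  case (Suc n)
  have split: "index_pairs (Suc n) = index_pairs n \<union> (\<lambda>i. (i, Suc n)) ` {1..n}"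
    by auto
  have "card (index_pairs (Suc n)) = card (index_pairs n) + card ((\<lambda>i. (i, Suc n)) ` {1..n})"
    unfolding split by (rule card_Un_disjoint) (auto simp: finite_index_pairs)
  also have "\<dots> = (n choose 2) + n"
    by (simp add: Suc.IH card_image inj_on_def)
  also have "\<dots> = Suc n choose 2"
    by (simp add: numeral_2_eq_2)
  finally show ?case .
qed

definition pair_average :: "nat \<Rightarrow> ('a \<Rightarrow> real) \<Rightarrow> (nat \<Rightarrow> 'a) \<Rightarrow> real" where
  "pair_average n w d =
     inverse (real (n choose 2)) * (\<Sum>(i1, i2)\<in>index_pairs n. w (d i1) * w (d i2))"

definition sample_average :: "nat \<Rightarrow> ('a \<Rightarrow> real) \<Rightarrow> (nat \<Rightarrow> 'a) \<Rightarrow> real" where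
  "sample_average n m d = 1 / real n * (\<Sum>i=1..n. m (d i))"

context
  fixes M :: "'a measure" and n :: nat
  assumes M: "prob_space M" and n: "2 \<le> n"
begin

lemma square_integrable_sample_average:
  "square_integrable M m \<Longrightarrow> square_integrable (PiM {1..n} (\<lambda>_. M)) (sample_average n m)"
  unfolding sample_average_def[abs_def]
  by (intro square_integrable_cmult square_integrable_sum iid_square_integrable_single M) auto

lemma square_integrable_pair_average:
  "square_integrable M w \<Longrightarrow> square_integrable (PiM {1..n} (\<lambda>_. M)) (pair_average n w)"
  unfolding pair_average_def[abs_def] case_prod_beta
  by (intro square_integrable_cmult square_integrable_sum iid_square_integrable_pair M) auto

lemma integral_sample_average:
  assumes "integrable M m"
  shows "(\<integral>d. sample_average n m d \<partial>PiM {1..n} (\<lambda>_. M)) = (\<integral>x. m x \<partial>M)"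
proof -
  note int = iid_single[OF M _ _ assms, of "{1..n}"]
  have "(\<integral>d. sample_average n m d \<partial>PiM {1..n} (\<lambda>_. M))
      = 1 / real n * (\<Sum>i=1..n. \<integral>d. m (d i) \<partial>PiM {1..n} (\<lambda>_. M))"
    unfolding sample_average_def using int(1) by (simp add: Bochner_Integration.integral_sum)
  also have "\<dots> = (\<integral>x. m x \<partial>M)"
    using int(2) n by simp
  finally show "(\<integral>d. sample_average n m d \<partial>PiM {1..n} (\<lambda>_. M)) = (\<integral>x. m x \<partial>M)" .
qed

lemma integral_pair_average:
  assumes w: "square_integrable M w"
  shows "(\<integral>d. pair_average n w d \<partial>PiM {1..n} (\<lambda>_. M)) = (\<integral>x. w x \<partial>M)\<^sup>2"
proof -
  interpret prob_space M by (rule M)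
  have iw: "integrable M w" using w by (rule square_integrable_integrable)
  note int = iid_pair[OF M _ _ _ _ iw iw, of "{1..n}"]
  have "(\<integral>d. pair_average n w d \<partial>PiM {1..n} (\<lambda>_. M))
      = inverse (real (n choose 2)) *
        (\<Sum>p\<in>index_pairs n. \<integral>d. w (d (fst p)) * w (d (snd p)) \<partial>PiM {1..n} (\<lambda>_. M))"
    unfolding pair_average_def case_prod_beta
    by (subst integral_mult_right_zero, subst Bochner_Integration.integral_sum)
       (auto intro!: int(1))
  also have "(\<Sum>p\<in>index_pairs n. \<integral>d. w (d (fst p)) * w (d (snd p)) \<partial>PiM {1..n} (\<lambda>_. M))
      = (\<Sum>p\<in>index_pairs n. (\<integral>x. w x \<partial>M)\<^sup>2)"
    by (intro sum.cong refl) (auto simp: int(2) power2_eq_square)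
  also have "inverse (real (n choose 2)) * \<dots> = (\<integral>x. w x \<partial>M)\<^sup>2"
    using n by (simp add: card_index_pairs)
  finally show ?thesis .
qed

text \<open>The constant is the one of Hoeffding's projection: the first-order part of a degree-two
  U-statistic with kernel \<open>w x * w y\<close> is \<open>2 * E w\<close> times the sample average of \<open>w - E w\<close>, because
  each pair of observations is met by exactly two single observations.\<close>

lemma integral_pair_average_times_sample_average:
  assumes w: "square_integrable M w" and m: "square_integrable M m" and m0: "(\<integral>x. m x \<partial>M) = 0"
  shows "(\<integral>d. pair_average n w d * sample_average n m d \<partial>PiM {1..n} (\<lambda>_. M))
    = 2 / real n * ((\<integral>x. w x \<partial>M) * (\<integral>x. w x * m x \<partial>M))"
proof -
  let ?P = "PiM {1..n} (\<lambda>_. M)"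
  let ?C = "(\<integral>x. w x \<partial>M) * (\<integral>x. w x * m x \<partial>M)"
  let ?b = "inverse (real (n choose 2))"
  have int: "integrable ?P (\<lambda>d. w (d (fst p)) * w (d (snd p)) * m (d l))"
    if "p \<in> index_pairs n" "l \<in> {1..n}" for p l
    using that
    by (intro square_integrable_mult iid_square_integrable_pair iid_square_integrable_single w m M)
       auto
  have hit: "(\<Sum>l=1..n. \<integral>d. w (d (fst p)) * w (d (snd p)) * m (d l) \<partial>?P) = 2 * ?C"
    if p: "p \<in> index_pairs n" for p
  proof -
    have "(\<Sum>l=1..n. \<integral>d. w (d (fst p)) * w (d (snd p)) * m (d l) \<partial>?P)
        = (\<Sum>l=1..n. if l = fst p \<or> l = snd p then ?C else 0)"
      using p by (intro sum.cong refl iid_pair_times_centred M w m m0) auto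
    also have "\<dots> = (\<Sum>l\<in>{fst p, snd p}. ?C)"
      using p by (intro sum.mono_neutral_cong_right) auto
    also have "\<dots> = 2 * ?C" using p by auto
    finally show ?thesis .
  qed
  have "(\<integral>d. pair_average n w d * sample_average n m d \<partial>?P)
      = (\<integral>d. ?b * (1 / real n) *
          (\<Sum>p\<in>index_pairs n. \<Sum>l=1..n. w (d (fst p)) * w (d (snd p)) * m (d l)) \<partial>?P)"
    unfolding pair_average_def sample_average_def case_prod_beta sum_product[symmetric]
    by (simp add: ac_simps)
  also have "\<dots> = ?b * (1 / real n) *
      (\<Sum>p\<in>index_pairs n. \<Sum>l=1..n. \<integral>d. w (d (fst p)) * w (d (snd p)) * m (d l) \<partial>?P)"
    by (subst integral_mult_right_zero, subst integral_double_sum) (auto intro!: int)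
  also have "\<dots> = ?b * (1 / real n) * (real (n choose 2) * (2 * ?C))"
    by (simp add: hit card_index_pairs)
  also have "\<dots> = 2 / real n * ?C"
    using n by simp
  finally show ?thesis .
qed

lemma integral_sample_average_times_sample_average:
  assumes f: "square_integrable M f" and m: "square_integrable M m" and m0: "(\<integral>x. m x \<partial>M) = 0"
  shows "(\<integral>d. sample_average n f d * sample_average n m d \<partial>PiM {1..n} (\<lambda>_. M))
    = 1 / real n * (\<integral>x. f x * m x \<partial>M)"
proof -
  interpret prob_space M by (rule M)
  let ?P = "PiM {1..n} (\<lambda>_. M)"
  let ?C = "\<integral>x. f x * m x \<partial>M"
  have fi: "integrable M f" and mi: "integrable M m"
    using f m by (simp_all add: square_integrable_integrable)
  have int: "integrable ?P (\<lambda>d. f (d i) * m (d l))" if "i \<in> {1..n}" "l \<in> {1..n}" for i l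
    using that by (intro square_integrable_mult iid_square_integrable_single f m M) auto
  have val: "(\<integral>d. f (d i) * m (d l) \<partial>?P) = (if l = i then ?C else 0)"
    if "i \<in> {1..n}" "l \<in> {1..n}" for i l
    using that m0 iid_single(2)[OF M _ that(1) square_integrable_mult[OF f m]]
      iid_pair(2)[OF M _ that _ fi mi] by auto
  have "(\<integral>d. sample_average n f d * sample_average n m d \<partial>?P)
      = (\<integral>d. 1 / real n * (1 / real n) * (\<Sum>i=1..n. \<Sum>l=1..n. f (d i) * m (d l)) \<partial>?P)"
    unfolding sample_average_def sum_product[symmetric] by (simp add: ac_simps)
  also have "\<dots> = 1 / real n * (1 / real n) *
      (\<Sum>i=1..n. \<Sum>l=1..n. \<integral>d. f (d i) * m (d l) \<partial>?P)"
    by (subst integral_mult_right_zero, subst integral_double_sum) (auto intro!: int)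
  also have "(\<Sum>i=1..n. \<Sum>l=1..n. \<integral>d. f (d i) * m (d l) \<partial>?P) = (\<Sum>i=1..n. ?C)"
    by (intro sum.cong refl) (simp add: val)
  also have "1 / real n * (1 / real n) * \<dots> = 1 / real n * ?C"
    using n by simp
  finally show ?thesis .
qed

end

section \<open>Conditional expectation\<close>

text \<open>For nonnegative functions, \<open>E (f g) = E (f E (g | F)) = c E f\<close> holds in the extended reals, so
  integrability of \<open>f\<close> passes to \<open>f g\<close>. The real-valued conditional expectation is the difference
  of the truncations to the reals of two extended ones, and truncation sends \<open>\<infinity>\<close> to \<open>0\<close>; hence
  the extended one must first be shown finite almost everywhere, which uses integrability of \<open>g\<close>.\<close>

lemma (in sigma_finite_subalgebra) integrable_mult_of_real_cond_exp_const:
  assumes f: "f \<in> borel_measurable F" "integrable M f" "\<And>x. 0 \<le> f x"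
    and g: "integrable M g" "\<And>x. 0 \<le> g x"
    and c: "AE x in M. real_cond_exp M F g x = c"
  shows "integrable M (\<lambda>x. f x * g x)"
proof -
  let ?N = "nn_cond_exp M F (\<lambda>x. ennreal (g x))"
  have [measurable]: "f \<in> borel_measurable M" "f \<in> borel_measurable F" "g \<in> borel_measurable M"
    using f(1,2) g(1) by auto
  have "(\<integral>\<^sup>+x. ?N x \<partial>M) = (\<integral>\<^sup>+x. ennreal (g x) \<partial>M)"
    using nn_cond_exp_intg[of "\<lambda>_. 1" "\<lambda>x. ennreal (g x)"] by simp
  also have "\<dots> < \<infinity>"
    using g by (simp add: nn_integral_eq_integral)
  finally have fin: "AE x in M. ?N x \<noteq> \<infinity>"
    by (intro nn_integral_noteq_infinite) auto
  (* The negative part of g vanishes, and so does its conditional expectation. *)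
  have neg: "AE x in M. nn_cond_exp M F (\<lambda>x. ennreal (- g x)) x = 0"
    using nn_cond_exp_F_meas[of "\<lambda>_. 0"] g(2) by (simp add: ennreal_neg)
  have eq: "AE x in M. ?N x = ennreal c"
    using fin neg c
  proof eventually_elim
    case (elim x)
    then have "enn2real (?N x) = c" by (simp add: real_cond_exp_def)
    then show ?case using elim(1) by (auto simp: less_top)
  qed
  have "(\<integral>\<^sup>+x. ennreal (f x * g x) \<partial>M) = (\<integral>\<^sup>+x. ennreal (f x) * ennreal (g x) \<partial>M)"
    using f(3) g(2) by (simp add: ennreal_mult)
  also have "\<dots> = (\<integral>\<^sup>+x. ennreal (f x) * ?N x \<partial>M)"
    by (rule nn_cond_exp_intg[symmetric]) auto
  also have "\<dots> = (\<integral>\<^sup>+x. ennreal (f x) * ennreal c \<partial>M)"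
    using eq by (intro nn_integral_cong_AE) auto
  also have "\<dots> = (\<integral>\<^sup>+x. ennreal (f x) \<partial>M) * ennreal c"
    by (simp add: nn_integral_multc)
  also have "\<dots> < \<infinity>"
    using f by (simp add: nn_integral_eq_integral ennreal_mult_less_top)
  finally show ?thesis
    using f(3) g(2) by (intro integrableI_bounded) auto
qed

section \<open>One observation of the linear model\<close>

lemma monomial_measurable [measurable]: "monomial k \<in> borel_measurable borel"
  unfolding monomial_def[abs_def] by measurable

lemma monomial_mult: "monomial k x * monomial l x = monomial (\<lambda>j. k j + l j) x"
  by (simp add: monomial_def power_add prod.distrib)

definition unit_exponent :: "'p \<Rightarrow> 'p \<Rightarrow> nat" where
  "unit_exponent j = (\<lambda>i. if i = j then 1 else 0)"

lemma monomial_unit_exponent: "monomial (unit_exponent j) x = x $ j"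
proof -
  have "monomial (unit_exponent j) x = (\<Prod>i\<in>UNIV. if i = j then x $ j else 1)"
    unfolding monomial_def unit_exponent_def by (intro prod.cong) auto
  then show ?thesis by simp
qed

lemma monomial_unit_exponents:
  "monomial (\<lambda>i. unit_exponent j i + unit_exponent j' i) x = x $ j * x $ j'"
  by (simp add: monomial_mult[symmetric] monomial_unit_exponent)

locale linear_model_obs =
  fixes \<mu> :: "(real^'p::finite) measure" and \<theta> :: "'p lm_param"
  assumes prob_\<mu>: "prob_space \<mu>" and sets_\<mu>: "sets \<mu> = sets borel"
    and moments: "has_all_moments \<mu>"
    and mean: "mean_vector \<mu> = 0" and cov: "covariance_matrix \<mu> = mat 1"
    and param: "\<theta> \<in> lm_params \<mu>"
begin

abbreviation Q :: "((real^'p) \<times> real) measure" where "Q \<equiv> obs_law \<mu> \<theta>"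

lemma kernel:
  "(\<lambda>x. distr (err_law \<theta> x) borel (\<lambda>e. (x, coef \<theta> \<bullet> x + e))) \<in> borel \<rightarrow>\<^sub>M prob_algebra borel"
proof -
  have [measurable]: "err_law \<theta> \<in> borel \<rightarrow>\<^sub>M prob_algebra borel"
    using param by (simp add: lm_params_def)
  show ?thesis
  proof (rule measurable_distr_prob_space2[where M=borel])
    have "(\<lambda>(x, e). (x, coef \<theta> \<bullet> x + e)) \<in> borel \<Otimes>\<^sub>M borel \<rightarrow>\<^sub>M borel \<Otimes>\<^sub>M borel"
      by measurable
    then show "(\<lambda>(x, e). (x, coef \<theta> \<bullet> x + e)) \<in> borel \<Otimes>\<^sub>M borel \<rightarrow>\<^sub>M borel"
      by (simp add: borel_prod)
  qed measurable
qed

lemma \<mu>_space: "\<mu> \<in> space (prob_algebra borel)"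
  by (simp add: space_prob_algebra sets_\<mu> prob_\<mu>)

sublocale Q: prob_space Q
  unfolding obs_law_def by (rule prob_space_bind'[OF \<mu>_space kernel])

lemma sets_Q [measurable_cong, simp]: "sets Q = sets borel"
  unfolding obs_law_def by (rule sets_bind'[OF \<mu>_space kernel])

lemma space_Q [simp]: "space Q = UNIV"
  using sets_eq_imp_space_eq[OF sets_Q] by simp

lemma fst_measurable: "fst \<in> Q \<rightarrow>\<^sub>M borel"
  by (simp add: borel_prod[symmetric] cong: measurable_cong_sets)

text \<open>The kernel records \<open>x\<close> unchanged in the first component, so projecting it gives the point mass
  at \<open>x\<close>; mixing point masses over \<open>\<mu>\<close> returns \<open>\<mu>\<close>.\<close>

lemma covariate_law: "distr Q borel fst = \<mu>"
proof -
  interpret mu: prob_space \<mu> by (rule prob_\<mu>)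
  have kernel_\<mu>: "(\<lambda>x. distr (err_law \<theta> x) borel (\<lambda>e. (x, coef \<theta> \<bullet> x + e)))
      \<in> \<mu> \<rightarrow>\<^sub>M prob_algebra borel"
    using kernel by (simp add: sets_\<mu> cong: measurable_cong_sets)
  have "distr Q borel fst =
      \<mu> \<bind> (\<lambda>x. distr (distr (err_law \<theta> x) borel (\<lambda>e. (x, coef \<theta> \<bullet> x + e))) borel fst)"
    unfolding obs_law_def
    by (rule distr_bind[OF measurable_prob_algebraD[OF kernel_\<mu>]])
       (auto simp: mu.not_empty borel_prod[symmetric])
  also have "\<dots> = \<mu> \<bind> return borel"
  proof (rule bind_cong[OF refl])
    fix x assume "x \<in> space \<mu>"
    have e: "prob_space (err_law \<theta> x)" "sets (err_law \<theta> x) = sets borel"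
      using param measurable_space[of "err_law \<theta>" borel "prob_algebra borel" x]
      by (auto simp: lm_params_def space_prob_algebra)
    interpret e: prob_space "err_law \<theta> x" by (rule e)
    have [measurable_cong]: "sets (err_law \<theta> x) = sets borel" by (rule e)
    have [measurable]: "(\<lambda>e. (x, coef \<theta> \<bullet> x + e)) \<in> err_law \<theta> x \<rightarrow>\<^sub>M borel \<Otimes>\<^sub>M borel"
      by measurable
    have "distr (distr (err_law \<theta> x) borel (\<lambda>e. (x, coef \<theta> \<bullet> x + e))) borel fst
        = distr (err_law \<theta> x) borel (\<lambda>e. x)"
      by (subst distr_distr) (auto simp: borel_prod[symmetric] comp_def)
    also have "\<dots> = return borel x" by simp
    finally show "distr (distr (err_law \<theta> x) borel (\<lambda>e. (x, coef \<theta> \<bullet> x + e))) borel fst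
        = return borel x" .
  qed
  also have "\<dots> = \<mu>" by (rule bind_return''[OF sets_\<mu>])
  finally show ?thesis .
qed

lemma integrable_covariate:
  "f \<in> borel_measurable borel \<Longrightarrow> integrable Q (\<lambda>z. f (fst z)) \<longleftrightarrow> integrable \<mu> (f :: _ \<Rightarrow> real)"
  by (subst covariate_law[symmetric]) (simp add: integrable_distr_eq fst_measurable)

lemma integral_covariate:
  "f \<in> borel_measurable borel \<Longrightarrow> (\<integral>z. f (fst z) \<partial>Q) = (\<integral>x. (f x :: real) \<partial>\<mu>)"
  by (subst covariate_law[symmetric]) (simp add: integral_distr fst_measurable)

lemma square_integrable_monomial: "square_integrable Q (\<lambda>z. monomial k (fst z))"
proof -
  have "integrable \<mu> (\<lambda>x. (monomial k x)\<^sup>2)"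
    using moments by (simp add: power2_eq_square monomial_mult has_all_moments_def)
  then show ?thesis
    using integrable_covariate[of "\<lambda>x. (monomial k x)\<^sup>2"]
    by (auto simp: square_integrable_def intro!: measurable_compose[OF fst_measurable])
qed

lemma square_integrable_covariate: "square_integrable Q (\<lambda>z. fst z $ j)"
  using square_integrable_monomial[of "unit_exponent j"] by (simp add: monomial_unit_exponent)

lemma square_integrable_covariate_product: "square_integrable Q (\<lambda>z. fst z $ j * fst z $ j')"
  using square_integrable_monomial[of "\<lambda>i. unit_exponent j i + unit_exponent j' i"]
  by (simp add: monomial_unit_exponents)

text \<open>Isotropy of the covariates enters the argument here; it identifies the mean of \<open>X\<^sub>j Y\<close> as the
  single coefficient \<open>\<beta>\<^sub>j\<close>.\<close>

lemma second_moment: "(\<integral>z. fst z $ j * fst z $ j' \<partial>Q) = (if j = j' then 1 else 0)"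
proof -
  have m: "(\<integral>x. x $ i \<partial>\<mu>) = 0" for i
    using mean by (simp add: mean_vector_def vec_eq_iff)
  have "(\<integral>x. x $ j * x $ j' \<partial>\<mu>) = covariance_matrix \<mu> $ j $ j'"
    using mean by (simp add: covariance_matrix_def)
  also have "\<dots> = (if j = j' then 1 else 0)"
    by (simp add: cov mat_def)
  finally show ?thesis
    using integral_covariate[of "\<lambda>x. x $ j * x $ j'"] by simp
qed

lemma sigma_X_subalgebra: "subalgebra Q sigma_X"
proof -
  have "fst -` A \<inter> UNIV \<in> sets Q" if "A \<in> sets borel" for A :: "(real^'p) set"
    using measurable_sets[OF fst_measurable that] by simp
  then show ?thesis
    by (auto simp: subalgebra_def sigma_X_def sets_vimage_algebra2)
qed

sublocale S: finite_measure_subalgebra Q sigma_X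
  by unfold_locales (rule sigma_X_subalgebra)

lemma measurable_sigma_X:
  "f \<in> borel_measurable borel \<Longrightarrow> (\<lambda>z. f (fst z) :: real) \<in> borel_measurable sigma_X"
  unfolding sigma_X_def
  by (rule measurable_compose[where g=f, OF measurable_vimage_algebra1]) auto

lemma square_integrable_residual: "square_integrable Q (residual \<theta>)"
  using param by (auto simp: lm_params_def square_integrable_def)

text \<open>A product of two \<open>L\<^sup>2\<close> functions is integrable, so conditioning on \<open>X\<close> turns the residual
  into \<open>E (\<epsilon> | X) = 0\<close>.\<close>

lemma integral_covariate_times_residual:
  assumes "f \<in> borel_measurable borel" "square_integrable Q (\<lambda>z. f (fst z))"
  shows "(\<integral>z. f (fst z) * residual \<theta> z \<partial>Q) = 0"
proof -
  have "(\<integral>z. f (fst z) * residual \<theta> z \<partial>Q)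
      = (\<integral>z. f (fst z) * real_cond_exp Q sigma_X (residual \<theta>) z \<partial>Q)"
    by (rule S.real_cond_exp_intg(2)[symmetric])
       (auto intro!: square_integrable_mult assms square_integrable_residual measurable_sigma_X
         square_integrable_measurable[OF square_integrable_residual])
  also have "\<dots> = (\<integral>z. 0 \<partial>Q)"
  proof (rule integral_cong_AE)
    show "AE z in Q. f (fst z) * real_cond_exp Q sigma_X (residual \<theta>) z = 0"
      using param by (auto simp: lm_params_def)
  qed (use square_integrable_measurable[OF assms(2)] in auto)
  finally show ?thesis by simp
qed

text \<open>Homoscedasticity replaces a fourth moment of \<open>\<epsilon>\<close>.\<close>

lemma square_integrable_covariate_times_residual:
  "square_integrable Q (\<lambda>z. fst z $ j * residual \<theta> z)"
proof -
  have "integrable Q (\<lambda>z. (fst z $ j)\<^sup>2 * (residual \<theta> z)\<^sup>2)"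
  proof (rule S.integrable_mult_of_real_cond_exp_const)
    show "(\<lambda>z. (fst z $ j)\<^sup>2) \<in> borel_measurable sigma_X"
      by (rule measurable_sigma_X[of "\<lambda>x. (x $ j)\<^sup>2"]) measurable
    show "AE z in Q. real_cond_exp Q sigma_X (\<lambda>z. (residual \<theta> z)\<^sup>2) z = sigma2 \<theta>"
      using param by (simp add: lm_params_def)
  qed (auto intro: square_integrable_power2 square_integrable_covariate square_integrable_residual)
  then show ?thesis
    using square_integrable_measurable[OF square_integrable_covariate]
      square_integrable_measurable[OF square_integrable_residual]
    by (auto simp add: square_integrable_def power_mult_distrib)
qed

lemma weighted_response_split:
  "fst z $ j * snd z
    = (\<Sum>j'\<in>UNIV. coef \<theta> $ j' * (fst z $ j * fst z $ j')) + fst z $ j * residual \<theta> z"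
  by (simp add: residual_def inner_vec_def sum_distrib_left algebra_simps)

lemma square_integrable_weighted_response: "square_integrable Q (\<lambda>z. fst z $ j * snd z)"
  unfolding weighted_response_split
  by (intro square_integrable_add square_integrable_sum square_integrable_cmult
      square_integrable_covariate_product square_integrable_covariate_times_residual)

text \<open>Against functions of the covariates the response acts as its regression \<open>\<beta>\<^sup>TX\<close>. Requiring
  \<open>X\<^sub>j m X\<close> to be square-integrable, and not only \<open>m X\<close>, makes its product with the residual
  integrable.\<close>

lemma integral_weighted_response_times_covariate:
  assumes m: "m \<in> borel_measurable borel" "square_integrable Q (\<lambda>z. m (fst z))"
    and jm: "square_integrable Q (\<lambda>z. fst z $ j * m (fst z))"
  shows "(\<integral>z. fst z $ j * snd z * m (fst z) \<partial>Q)
    = (\<Sum>j'\<in>UNIV. coef \<theta> $ j' * (\<integral>z. fst z $ j * fst z $ j' * m (fst z) \<partial>Q))"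
proof -
  have 1: "integrable Q (\<lambda>z. fst z $ j * fst z $ j' * m (fst z))" for j'
    by (intro square_integrable_mult square_integrable_covariate_product m)
  have 2: "integrable Q (\<lambda>z. fst z $ j * m (fst z) * residual \<theta> z)"
    by (intro square_integrable_mult jm square_integrable_residual)
  have 3: "(\<integral>z. fst z $ j * m (fst z) * residual \<theta> z \<partial>Q) = 0"
    by (rule integral_covariate_times_residual[of "\<lambda>x. x $ j * m x"])
       (use m jm in measurable)
  have "(\<integral>z. fst z $ j * snd z * m (fst z) \<partial>Q)
      = (\<integral>z. (\<Sum>j'\<in>UNIV. coef \<theta> $ j' * (fst z $ j * fst z $ j' * m (fst z)))
            + fst z $ j * m (fst z) * residual \<theta> z \<partial>Q)"
    unfolding weighted_response_split by (simp add: sum_distrib_right sum_distrib_left algebra_simps)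
  also have "\<dots> = (\<Sum>j'\<in>UNIV. coef \<theta> $ j' * (\<integral>z. fst z $ j * fst z $ j' * m (fst z) \<partial>Q))"
    using 1 2 3 by (simp add: Bochner_Integration.integral_sum)
  finally show ?thesis .
qed

lemma mean_weighted_response: "(\<integral>z. fst z $ j * snd z \<partial>Q) = coef \<theta> $ j"
  using integral_weighted_response_times_covariate[of "\<lambda>_. 1" j]
  by (simp add: Q.square_integrable_const square_integrable_covariate second_moment
      if_distrib[of "\<lambda>c. _ * c"] cong: if_cong)

end

section \<open>The linear span of the zero-estimators\<close>

definition centred_polynomial ::
    "(real^'p::finite) measure \<Rightarrow> (('p \<Rightarrow> nat) \<Rightarrow> real) \<Rightarrow> ('p \<Rightarrow> nat) set \<Rightarrow> real^'p \<Rightarrow> real" where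
  "centred_polynomial \<mu> c K x = (\<Sum>k\<in>K. c k * (monomial k x - (\<integral>y. monomial k y \<partial>\<mu>)))"

lemma centred_polynomial_measurable [measurable]: "centred_polynomial \<mu> c K \<in> borel_measurable borel"
  unfolding centred_polynomial_def[abs_def] by measurable

lemma zero_family_combination_eq_sample_average:
  "(\<Sum>k\<in>K. c k * g_zero n \<mu> k d) = sample_average n (\<lambda>z. centred_polynomial \<mu> c K (fst z)) d"
proof -
  have "(\<Sum>i=1..n. centred_polynomial \<mu> c K (fst (d i)))
      = (\<Sum>k\<in>K. \<Sum>i=1..n. c k * (monomial k (fst (d i)) - (\<integral>y. monomial k y \<partial>\<mu>)))"
    unfolding centred_polynomial_def by (rule sum.swap)
  then show ?thesis
    by (simp add: g_zero_def sample_average_def sum_distrib_left ac_simps)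
qed

lemma zero_family_sample_averageE:
  assumes "g \<in> zero_family n \<mu>"
  obtains c K where "finite K" "g = sample_average n (\<lambda>z. centred_polynomial \<mu> c K (fst z))"
  using assms by (auto simp: zero_family_def zero_family_combination_eq_sample_average)

lemma zero_family_diff:
  assumes "g \<in> zero_family n \<mu>" and "g' \<in> zero_family n \<mu>"
  shows "(\<lambda>d. g d - g' d) \<in> zero_family n \<mu>"
proof -
  obtain K c where K: "finite K" and g: "g = (\<lambda>d. \<Sum>k\<in>K. c k * g_zero n \<mu> k d)"
    using assms(1) by (auto simp: zero_family_def)
  obtain K' c' where K': "finite K'" and g': "g' = (\<lambda>d. \<Sum>k\<in>K'. c' k * g_zero n \<mu> k d)"
    using assms(2) by (auto simp: zero_family_def)
  define b where "b k = (if k \<in> K then c k else 0) - (if k \<in> K' then c' k else 0)" for k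
  have "g d - g' d = (\<Sum>k\<in>K \<union> K'. b k * g_zero n \<mu> k d)" for d
  proof -
    have "g d = (\<Sum>k\<in>K \<union> K'. (if k \<in> K then c k else 0) * g_zero n \<mu> k d)"
      unfolding g using K K' by (intro sum.mono_neutral_cong_left) auto
    moreover have "g' d = (\<Sum>k\<in>K \<union> K'. (if k \<in> K' then c' k else 0) * g_zero n \<mu> k d)"
      unfolding g' using K K' by (intro sum.mono_neutral_cong_left) auto
    ultimately show ?thesis
      by (simp add: b_def left_diff_distrib sum_subtractf)
  qed
  then show ?thesis
    using K K' unfolding zero_family_def by blast
qed

lemma h_stat_eq_g_zero:
  "h_stat n \<mu> j j' d = g_zero n \<mu> (\<lambda>i. unit_exponent j i + unit_exponent j' i) d"
  by (simp add: h_stat_def g_zero_def monomial_unit_exponents)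

text \<open>The pairs \<open>(j, j')\<close> and \<open>(j', j)\<close> give the same monomial, so the coefficient of a monomial is
  the sum over all pairs that give it.\<close>

lemma quadratic_correction_in_zero_family:
  fixes \<theta> :: "'p::finite lm_param"
  shows "(\<lambda>d. a * (\<Sum>j\<in>UNIV. \<Sum>j'\<in>UNIV. psi_stat n \<mu> \<theta> j j' d)) \<in> zero_family n \<mu>"
proof -
  let ?S = "UNIV :: ('p \<times> 'p) set"
  define e where "e p = (\<lambda>i. unit_exponent (fst p) i + unit_exponent (snd p) i)" for p :: "'p \<times> 'p"
  define b where "b p = a * (coef \<theta> $ fst p * coef \<theta> $ snd p)" for p
  have "a * (\<Sum>j\<in>UNIV. \<Sum>j'\<in>UNIV. psi_stat n \<mu> \<theta> j j' d)
      = (\<Sum>k\<in>e ` ?S. (\<Sum>p | p \<in> ?S \<and> e p = k. b p) * g_zero n \<mu> k d)" for d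
  proof -
    have "a * (\<Sum>j\<in>UNIV. \<Sum>j'\<in>UNIV. psi_stat n \<mu> \<theta> j j' d) = (\<Sum>p\<in>?S. b p * g_zero n \<mu> (e p) d)"
      by (simp add: psi_stat_def h_stat_eq_g_zero sum.cartesian_product sum_distrib_left
          case_prod_beta b_def e_def mult.assoc)
    also have "\<dots> = (\<Sum>k\<in>e ` ?S. \<Sum>p | p \<in> ?S \<and> e p = k. b p * g_zero n \<mu> (e p) d)"
      by (rule sum.image_gen) simp
    also have "\<dots> = (\<Sum>k\<in>e ` ?S. (\<Sum>p | p \<in> ?S \<and> e p = k. b p) * g_zero n \<mu> k d)"
      unfolding sum_distrib_right by (intro sum.cong refl) auto
    finally show ?thesis .
  qed
  then have "(\<lambda>d. a * (\<Sum>j\<in>UNIV. \<Sum>j'\<in>UNIV. psi_stat n \<mu> \<theta> j j' d))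
      = (\<lambda>d. \<Sum>k\<in>e ` ?S. (\<Sum>p | p \<in> ?S \<and> e p = k. b p) * g_zero n \<mu> k d)"
    by (rule ext)
  moreover have "finite (e ` ?S)" by simp
  ultimately show ?thesis unfolding zero_family_def mem_Collect_eq by (intro exI conjI)
qed

lemma naive_est_eq_pair_averages:
  "naive_est n d = (\<Sum>j\<in>UNIV. pair_average n (\<lambda>z. fst z $ j * snd z) d)"
proof -
  have "(\<Sum>(i1, i2)\<in>index_pairs n. W d i1 \<bullet> W d i2)
      = (\<Sum>p\<in>index_pairs n. \<Sum>j\<in>UNIV. (fst (d (fst p)) $ j * snd (d (fst p))) *
          (fst (d (snd p)) $ j * snd (d (snd p))))"
    by (simp add: W_def inner_vec_def case_prod_beta)
  also have "\<dots> = (\<Sum>j\<in>UNIV. \<Sum>p\<in>index_pairs n. (fst (d (fst p)) $ j * snd (d (fst p))) *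
          (fst (d (snd p)) $ j * snd (d (snd p))))"
    by (rule sum.swap)
  finally show ?thesis
    by (simp add: naive_est_def pair_average_def sum_distrib_left case_prod_beta)
qed

section \<open>Optimality of the oracle estimator\<close>

locale linear_model_sample = linear_model_obs \<mu> \<theta>
  for \<mu> :: "(real^'p::finite) measure" and \<theta> +
  fixes n :: nat
  assumes n: "2 \<le> n"
begin

abbreviation P :: "(nat \<Rightarrow> (real^'p) \<times> real) measure" where "P \<equiv> sample_law n \<mu> \<theta>"

sublocale P: prob_space P
  unfolding sample_law_def by (rule prob_space_PiM) (rule Q.prob_space_axioms)

lemmas obs_prob = Q.prob_space_axioms

lemma square_integrable_centred_polynomial:
  "square_integrable Q (\<lambda>z. centred_polynomial \<mu> c K (fst z))"
  unfolding centred_polynomial_def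
  by (intro square_integrable_sum square_integrable_cmult square_integrable_diff
      square_integrable_monomial Q.square_integrable_const)

lemma square_integrable_covariate_times_centred_polynomial:
  "square_integrable Q (\<lambda>z. fst z $ j * centred_polynomial \<mu> c K (fst z))"
proof -
  have "square_integrable Q (\<lambda>z. fst z $ j * monomial k (fst z))" for k
    using square_integrable_monomial[of "\<lambda>i. unit_exponent j i + k i"]
    by (simp add: monomial_mult[symmetric] monomial_unit_exponent)
  then have "square_integrable Q (\<lambda>z. \<Sum>k\<in>K. c k * (fst z $ j * monomial k (fst z)
      - (\<integral>y. monomial k y \<partial>\<mu>) * fst z $ j))"
    by (intro square_integrable_sum square_integrable_cmult square_integrable_diff
        square_integrable_covariate)
  then show ?thesis
    by (simp add: centred_polynomial_def sum_distrib_left algebra_simps)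
qed

lemma integral_centred_polynomial: "(\<integral>z. centred_polynomial \<mu> c K (fst z) \<partial>Q) = 0"
proof -
  have "integrable Q (\<lambda>z. monomial k (fst z))" for k
    by (rule Q.square_integrable_integrable[OF square_integrable_monomial])
  then show ?thesis
    by (simp add: centred_polynomial_def Bochner_Integration.integral_sum
        integral_covariate Q.prob_space[simplified])
qed

lemma zero_family_square_integrable:
  assumes "g \<in> zero_family n \<mu>"
  shows "square_integrable P g"
  using assms
  by (elim zero_family_sample_averageE)
     (simp add: sample_law_def square_integrable_sample_average[OF obs_prob n]
       square_integrable_centred_polynomial)

lemma zero_family_integral:
  assumes "g \<in> zero_family n \<mu>"
  shows "(\<integral>d. g d \<partial>P) = 0"
  using assms
  by (elim zero_family_sample_averageE)
     (simp add: sample_law_def integral_sample_average[OF obs_prob n] integral_centred_polynomial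
       Q.square_integrable_integrable square_integrable_centred_polynomial)

lemma square_integrable_naive_est: "square_integrable P (naive_est n)"
  unfolding sample_law_def naive_est_eq_pair_averages[abs_def]
  by (intro square_integrable_sum square_integrable_pair_average[OF obs_prob n]
      square_integrable_weighted_response)

lemma integral_naive_est: "(\<integral>d. naive_est n d \<partial>P) = tau2 \<theta>"
proof -
  have "integrable P (pair_average n (\<lambda>z. fst z $ j * snd z))" for j
    unfolding sample_law_def
    by (intro P.square_integrable_integrable[unfolded sample_law_def]
        square_integrable_pair_average[OF obs_prob n] square_integrable_weighted_response)
  then have "(\<integral>d. naive_est n d \<partial>P) = (\<Sum>j\<in>UNIV. \<integral>d. pair_average n (\<lambda>z. fst z $ j * snd z) d \<partial>P)"
    by (simp add: naive_est_eq_pair_averages Bochner_Integration.integral_sum)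
  also have "\<dots> = (\<Sum>j\<in>UNIV. (coef \<theta> $ j)\<^sup>2)"
    unfolding sample_law_def
    by (simp add: integral_pair_average[OF obs_prob n square_integrable_weighted_response]
        mean_weighted_response)
  also have "\<dots> = tau2 \<theta>"
    unfolding tau2_def power2_norm_eq_inner inner_vec_def by (simp add: power2_eq_square)
  finally show ?thesis .
qed

text \<open>With \<open>g\<close> the sample average of \<open>m X\<close>, both the naive estimator and the correction have
  covariance \<open>2/n * E ((\<beta>\<^sup>TX)\<^sup>2 m X)\<close> with \<open>g\<close>. In the proof \<open>?V\<close> is this last expectation,
  expanded over the coordinates.\<close>

lemma T_oracle_uncorrelated:
  assumes g: "g \<in> zero_family n \<mu>"
  shows "(\<integral>d. T_oracle n \<mu> \<theta> d * g d \<partial>P) = 0"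
proof -
  obtain c K where g_eq: "g = sample_average n (\<lambda>z. centred_polynomial \<mu> c K (fst z))"
    using g by (rule zero_family_sample_averageE)
  let ?m = "\<lambda>z :: (real^'p) \<times> real. centred_polynomial \<mu> c K (fst z)"
  note m = square_integrable_centred_polynomial[of c K]
  note m0 = integral_centred_polynomial[of c K]
  define q where "q j j' z = fst z $ j * fst z $ j' - (\<integral>x. x $ j * x $ j' \<partial>\<mu>)"
    for j j' and z :: "(real^'p) \<times> real"
  have q: "square_integrable Q (q j j')" for j j'
    unfolding q_def
    by (intro square_integrable_diff square_integrable_covariate_product Q.square_integrable_const)
  have h_eq: "h_stat n \<mu> j j' d = sample_average n (q j j') d" for j j' d
    by (simp add: h_stat_def sample_average_def q_def)
  let ?E = "\<lambda>j j'. \<integral>z. fst z $ j * fst z $ j' * ?m z \<partial>Q"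
  let ?V = "\<Sum>j\<in>UNIV. \<Sum>j'\<in>UNIV. coef \<theta> $ j * coef \<theta> $ j' * ?E j j'"
  have iT: "integrable P (\<lambda>d. pair_average n (\<lambda>z. fst z $ j * snd z) d * g d)" for j
    unfolding sample_law_def g_eq
    by (intro square_integrable_mult square_integrable_pair_average[OF obs_prob n]
        square_integrable_sample_average[OF obs_prob n] square_integrable_weighted_response m)
  have ih: "integrable P (\<lambda>d. h_stat n \<mu> j j' d * g d)" for j j'
    unfolding sample_law_def g_eq h_eq
    by (intro square_integrable_mult square_integrable_sample_average[OF obs_prob n] q m)
  have "(\<integral>d. naive_est n d * g d \<partial>P)
      = (\<Sum>j\<in>UNIV. \<integral>d. pair_average n (\<lambda>z. fst z $ j * snd z) d * g d \<partial>P)"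
    using iT by (simp add: naive_est_eq_pair_averages sum_distrib_right
        Bochner_Integration.integral_sum)
  also have "\<dots> = (\<Sum>j\<in>UNIV. 2 / real n *
      (coef \<theta> $ j * (\<Sum>j'\<in>UNIV. coef \<theta> $ j' * ?E j j')))"
    unfolding sample_law_def g_eq
    by (simp add: integral_pair_average_times_sample_average[OF obs_prob n
          square_integrable_weighted_response m m0] mean_weighted_response
        integral_weighted_response_times_covariate[OF centred_polynomial_measurable m
          square_integrable_covariate_times_centred_polynomial])
  also have "\<dots> = 2 / real n * ?V"
    by (simp add: sum_distrib_left mult.assoc)
  finally have T: "(\<integral>d. naive_est n d * g d \<partial>P) = 2 / real n * ?V" .
  (* The centring constant of q drops out because m has mean zero. *)
  have qm: "(\<integral>z. q j j' z * ?m z \<partial>Q) = ?E j j'" for j j'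
    using square_integrable_mult[OF square_integrable_covariate_product m, of j j']
      Q.square_integrable_integrable[OF m] m0
    by (simp add: q_def left_diff_distrib)
  have h: "(\<integral>d. h_stat n \<mu> j j' d * g d \<partial>P) = 1 / real n * ?E j j'" for j j'
    unfolding sample_law_def g_eq h_eq
    by (simp add: integral_sample_average_times_sample_average[OF obs_prob n q m m0] qm)
  have "(\<integral>d. T_oracle n \<mu> \<theta> d * g d \<partial>P) = (\<integral>d. naive_est n d * g d
      - 2 * (\<Sum>j\<in>UNIV. \<Sum>j'\<in>UNIV. coef \<theta> $ j * coef \<theta> $ j' * (h_stat n \<mu> j j' d * g d)) \<partial>P)"
    by (simp add: T_oracle_def psi_stat_def left_diff_distrib sum_distrib_right mult.assoc)
  also have "\<dots> = (\<integral>d. naive_est n d * g d \<partial>P)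
      - 2 * (\<Sum>j\<in>UNIV. \<Sum>j'\<in>UNIV. coef \<theta> $ j * coef \<theta> $ j' * (\<integral>d. h_stat n \<mu> j j' d * g d \<partial>P))"
    using ih square_integrable_mult[OF square_integrable_naive_est zero_family_square_integrable[OF g]]
    by (simp add: Bochner_Integration.integral_sum)
  also have "\<dots> = 2 / real n * ?V - 2 * (1 / real n * ?V)"
    unfolding T h by (simp add: sum_distrib_left ac_simps)
  finally show ?thesis by simp
qed

lemma T_oracle_variance_le:
  assumes g: "g \<in> zero_family n \<mu>"
  shows "P.variance (T_oracle n \<mu> \<theta>) \<le> P.variance (\<lambda>d. naive_est n d + g d)"
proof -
  let ?c = "\<lambda>d. - 2 * (\<Sum>j\<in>UNIV. \<Sum>j'\<in>UNIV. psi_stat n \<mu> \<theta> j j' d)"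
  have c: "?c \<in> zero_family n \<mu>" by (rule quadratic_correction_in_zero_family)
  have T: "T_oracle n \<mu> \<theta> = (\<lambda>d. naive_est n d + ?c d)"
    by (simp add: T_oracle_def fun_eq_iff)
  define D where "D d = g d - ?c d" for d
  have D: "D \<in> zero_family n \<mu>"
    unfolding D_def[abs_def] by (rule zero_family_diff[OF g c])
  have S: "square_integrable P (T_oracle n \<mu> \<theta>)"
    unfolding T
    by (intro square_integrable_add square_integrable_naive_est zero_family_square_integrable c)
  have "P.variance (T_oracle n \<mu> \<theta>) \<le> P.variance (\<lambda>d. T_oracle n \<mu> \<theta> d + D d)"
    by (rule P.variance_le_of_uncorrelated[OF S zero_family_square_integrable[OF D]
          zero_family_integral[OF D] T_oracle_uncorrelated[OF D]])
  also have "(\<lambda>d. T_oracle n \<mu> \<theta> d + D d) = (\<lambda>d. naive_est n d + g d)"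
    by (simp add: T D_def fun_eq_iff)
  finally show ?thesis .
qed

end

theorem theorem2p2:
  fixes \<mu> :: "(real^'p::finite) measure" and n :: nat
  assumes "prob_space \<mu>" and "sets \<mu> = sets borel"
    and "has_all_moments \<mu>"
    and "mean_vector \<mu> = 0" and "covariance_matrix \<mu> = mat 1"
    and "n \<ge> 2"
  shows "optimal_oracle_estimator (lm_params \<mu>) (sample_law n \<mu>) tau2
           (naive_est n) (zero_family n \<mu>) (T_oracle n \<mu>)"
proof -
  have sample: "linear_model_sample \<mu> \<theta> n" if "\<theta> \<in> lm_params \<mu>" for \<theta>
    using assms that
    by (simp add: linear_model_sample_def linear_model_sample_axioms_def linear_model_obs_def)
  have unbiased: "unbiased_estimator (lm_params \<mu>) (sample_law n \<mu>) tau2 (naive_est n)"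
    unfolding unbiased_estimator_def
  proof
    fix \<theta> assume "\<theta> \<in> lm_params \<mu>"
    then interpret linear_model_sample \<mu> \<theta> n by (rule sample)
    show "integrable P (naive_est n) \<and> P.expectation (naive_est n) = tau2 \<theta>"
      using P.square_integrable_integrable[OF square_integrable_naive_est] integral_naive_est
      by simp
  qed
  have zero: "zero_estimator (lm_params \<mu>) (sample_law n \<mu>) g" if g: "g \<in> zero_family n \<mu>" for g
    unfolding zero_estimator_def
  proof
    fix \<theta> assume "\<theta> \<in> lm_params \<mu>"
    then interpret linear_model_sample \<mu> \<theta> n by (rule sample)
    show "integrable P g \<and> P.expectation g = 0"
      using P.square_integrable_integrable[OF zero_family_square_integrable[OF g]]
        zero_family_integral[OF g] by simp
  qed
  have member: "\<exists>gs\<in>zero_family n \<mu>. T_oracle n \<mu> \<theta> = (\<lambda>d. naive_est n d + gs d)" for \<theta>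
    by (rule bexI[OF _ quadratic_correction_in_zero_family[of "-2" n \<mu> \<theta>]])
       (simp add: T_oracle_def fun_eq_iff)
  have optimal: "integrable (sample_law n \<mu> \<theta>) (\<lambda>d. (naive_est n d + g d)\<^sup>2) \<and>
      prob_space.variance (sample_law n \<mu> \<theta>) (T_oracle n \<mu> \<theta>)
        \<le> prob_space.variance (sample_law n \<mu> \<theta>) (\<lambda>d. naive_est n d + g d)"
    if g: "g \<in> zero_family n \<mu>" and \<theta>: "\<theta> \<in> lm_params \<mu>" for g \<theta>
  proof -
    interpret linear_model_sample \<mu> \<theta> n using \<theta> by (rule sample)
    show ?thesis
      using square_integrable_power2[OF square_integrable_add[OF square_integrable_naive_est
            zero_family_square_integrable[OF g]]] T_oracle_variance_le[OF g]
      by simp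
  qed
  show ?thesis
    unfolding optimal_oracle_estimator_def using unbiased zero member optimal by blast
qed

end
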